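(* Let $n \geqslant 4$ be an integer, and let $\Gamma$ be the Cayley graph of the symmetric group $S_n$ generated by $(1\,2)$, $(1\,2\,\dots\,n)$, $(1\,n\,\dots\,2)$. Then $$ \mathrm{diam}(\Gamma) \geqslant \frac{n(n-1)}{2}. $$
   Context: Let $\delta = (1\,2)$, $r = (1\,2\,\dots\,n)$ and $r^{-1} = (1\,n\,\dots\,2)$ in $S_n$ (cycle notation). The Cayley graph $\Gamma$ has vertex set $S_n$ and edge set $\{\{g,h\} : g,h\in S_n,\ g^{-1}h \in \{\delta, r, r^{-1}\}\}$. All edges have weight one. $\mathrm{dist}(\pi,\xi)$ denotes the length of a shortest path in $\Gamma$ between $\pi$ and $\xi$, and $\mathrm{diam}(\Gamma) = \max_{\pi,\xi\in S_n} \mathrm{dist}(\pi,\xi)$. *)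

theory Defs
  imports "HOL-Algebra.Sym_Groups" "Graph_Theory.Graph_Theory"
begin

text \<open>
  Edges are unordered pairs of vertices; the graph is the symmetric digraph that has, for each
  edge, its two orientations as arcs.
\<close>

definition cayley_edges :: "('a, 'b) monoid_scheme \<Rightarrow> 'a set \<Rightarrow> 'a set set" where
  "cayley_edges G S =
     {{g, h} | g h. g \<in> carrier G \<and> h \<in> carrier G \<and> inv\<^bsub>G\<^esub> g \<otimes>\<^bsub>G\<^esub> h \<in> S}"

definition cayley_graph :: "('a, 'b) monoid_scheme \<Rightarrow> 'a set \<Rightarrow> 'a pair_pre_digraph" where
  "cayley_graph G S = \<lparr> pverts = carrier G, parcs = {(g, h). {g, h} \<in> cayley_edges G S} \<rparr>"

definition dist_graph :: "('a, 'b) pre_digraph \<Rightarrow> 'a \<Rightarrow> 'a \<Rightarrow> ereal" where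
  "dist_graph G u v = wf_digraph.\<mu> G (\<lambda>_. 1) u v"

definition diam :: "('a, 'b) pre_digraph \<Rightarrow> ereal" where
  "diam G = Max {dist_graph G u v | u v. u \<in> verts G \<and> v \<in> verts G}"

definition swap12 :: "nat \<Rightarrow> nat" where
  "swap12 = cycle_of_list [1, 2]"

definition rot :: "nat \<Rightarrow> nat \<Rightarrow> nat" where
  "rot n = cycle_of_list [1..<Suc n]"

definition rot_inv :: "nat \<Rightarrow> nat \<Rightarrow> nat" where
  "rot_inv n = cycle_of_list (1 # rev [2..<Suc n])"

text \<open>
  Multiplication in \<^const>\<open>sym_group\<close> is composition from right to left. The opposite convention
  gives an isomorphic graph, via inversion, because the connection set is closed under inverses.
\<close>

definition Gamma :: "nat \<Rightarrow> (nat \<Rightarrow> nat) pair_pre_digraph" where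
  "Gamma n = cayley_graph (sym_group n) {swap12, rot n, rot_inv n}"


lemma cycle_of_list_nth:
  assumes "distinct cs" "i < length cs"
  shows "cycle_of_list cs (cs ! i) = cs ! (Suc i mod length cs)"
proof -
  have "map (cycle_of_list cs) cs = rotate1 cs"
    using cyclic_rotation[OF assms(1), of 1] by simp
  then have "map (cycle_of_list cs) cs ! i = rotate1 cs ! i" by simp
  then show ?thesis using assms(2) by (simp add: nth_rotate1)
qed

lemma rot_apply:
  assumes "1 \<le> i" "i \<le> n"
  shows "rot n i = (if i = n then 1 else Suc i)"
proof -
  have "rot n ([1..<Suc n] ! (i - 1)) = [1..<Suc n] ! (Suc (i - 1) mod length [1..<Suc n])"
    unfolding rot_def by (rule cycle_of_list_nth) (use assms in auto)
  then show ?thesis using assms by (auto simp del: upt_Suc)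
qed

lemma rot_inv_apply:
  assumes "1 \<le> i" "i \<le> n"
  shows "rot_inv n i = (if i = 1 then n else i - 1)"
proof -
  let ?l = "1 # rev [2..<Suc n]"
  have len: "length ?l = n" using assms by (cases n) (simp_all del: upt_Suc)
  have nth: "?l ! k = (if k = 0 then 1 else Suc n - k)" if "k < n" for k
    using that by (cases k) (auto simp: rev_nth simp del: upt_Suc)
  have *: "rot_inv n (?l ! k) = ?l ! (Suc k mod n)" if "k < n" for k
    unfolding rot_inv_def using cycle_of_list_nth[of ?l k] that len by simp
  show ?thesis
  proof (cases "i = 1")
    case True
    show ?thesis using *[of 0] nth[of "1 mod n"] assms True
      by (cases "n = 1") (simp_all del: upt_Suc)
  next
    case False
    then have i: "?l ! (Suc n - i) = i" "Suc n - i < n" using nth[of "Suc n - i"] assms by auto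
    have "rot_inv n i = ?l ! (Suc (Suc n - i) mod n)" using *[OF i(2)] i(1) by simp
    also have "\<dots> = i - 1"
    proof (cases "i = 2")
      case True
      then show ?thesis using assms by (simp add: Suc_diff_le)
    next
      case False
      with \<open>i \<noteq> 1\<close> assms have "Suc (Suc n - i) < n" by simp
      then show ?thesis using nth[of "Suc (Suc n - i)"] assms by auto
    qed
    finally show ?thesis using False by simp
  qed
qed

lemma rot_permutes: "rot n permutes {1..n}"
  using cycle_permutes[of "[1..<Suc n]"] by (simp add: rot_def atLeastLessThanSuc_atLeastAtMost del: upt_Suc)

lemma rot_inv_permutes:
  assumes "1 \<le> n" shows "rot_inv n permutes {1..n}"
proof -
  have "set (1 # rev [2..<Suc n]) = {1..n}" using assms by auto
  then show ?thesis using cycle_permutes[of "1 # rev [2..<Suc n]"] by (simp add: rot_inv_def)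
qed

lemma rot_inv_eq:
  assumes "1 \<le> n" shows "rot_inv n = inv' (rot n)"
proof -
  have "rot n (rot_inv n i) = i" for i
  proof (cases "i \<in> {1..n}")
    case True
    then show ?thesis by (auto simp: rot_inv_apply rot_apply)
  next
    case False
    then show ?thesis
      using rot_inv_permutes[OF assms] rot_permutes[of n] by (simp add: permutes_def)
  qed
  then have "rot n \<circ> rot_inv n = id" by auto
  then show ?thesis
    by (metis comp_assoc comp_id id_comp permutes_inv_o(2) rot_permutes)
qed

lemma swap12_eq: "swap12 = transpose 1 2"
  by (simp add: swap12_def)

context
  fixes n :: nat
  assumes n: "3 \<le> n"
begin

lemma swap12_permutes: "swap12 permutes {1..n}"
  unfolding swap12_eq using n by (intro permutes_swap_id) auto

lemma arc_iff:
  "(g, h) \<in> parcs (Gamma n) \<longleftrightarrow>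
     g permutes {1..n} \<and> h permutes {1..n} \<and> inv' g \<circ> h \<in> {swap12, rot n, rot_inv n}"
    (is "?L \<longleftrightarrow> ?R g h")
proof -
  have inv_R: "?R b a" if "?R a b" for a b
  proof -
    have ab: "a permutes {1..n}" "b permutes {1..n}" using that by auto
    have "inv' b \<circ> a = inv' (inv' a \<circ> b)"
      using ab by (metis o_inv_distrib permutes_bij permutes_inv permutes_inv_inv)
    moreover have "inv' swap12 = swap12" by (simp add: swap12_eq)
    moreover have "inv' (rot n) = rot_inv n" "inv' (rot_inv n) = rot n"
      using n rot_inv_eq permutes_inv_inv[OF rot_permutes] by auto
    moreover have "inv' a \<circ> b = swap12 \<or> inv' a \<circ> b = rot n \<or> inv' a \<circ> b = rot_inv n"
      using that by blast
    ultimately have "inv' b \<circ> a \<in> {swap12, rot n, rot_inv n}" by (elim disjE) (metis insertCI)+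
    then show ?thesis using ab by blast
  qed
  let ?G = "sym_group n" and ?S = "{swap12, rot n, rot_inv n}"
  have R: "a \<in> carrier ?G \<and> b \<in> carrier ?G \<and> inv\<^bsub>?G\<^esub> a \<otimes>\<^bsub>?G\<^esub> b \<in> ?S \<longleftrightarrow> ?R a b" for a b
    unfolding sym_group_mult sym_group_carrier
    using sym_group_inv_equality[of a n] sym_group_carrier[of a n] by metis
  have "?L \<longleftrightarrow> {g, h} \<in> cayley_edges ?G ?S" by (simp add: Gamma_def cayley_graph_def)
  also have "\<dots> \<longleftrightarrow> (\<exists>a b. {g, h} = {a, b} \<and> ?R a b)"
    unfolding cayley_edges_def R by blast
  also have "\<dots> \<longleftrightarrow> ?R g h \<or> ?R h g" unfolding doubleton_eq_iff by blast
  finally have "?L \<longleftrightarrow> ?R g h \<or> ?R h g" .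
  then show ?thesis using inv_R by blast
qed

lemma pair_graph_Gamma: "pair_graph (Gamma n)"
proof
  have verts: "pverts (Gamma n) = {p. p permutes {1..n}}"
    by (simp add: Gamma_def cayley_graph_def sym_group_def)
  show fin: "finite (pverts (Gamma n))" by (simp add: verts finite_permutations)
  show fst: "fst e \<in> pverts (Gamma n)" if "e \<in> parcs (Gamma n)" for e
    using that arc_iff[of "fst e" "snd e"] verts by simp
  show snd: "snd e \<in> pverts (Gamma n)" if "e \<in> parcs (Gamma n)" for e
    using that arc_iff[of "fst e" "snd e"] verts by simp
  have "parcs (Gamma n) \<subseteq> pverts (Gamma n) \<times> pverts (Gamma n)"
    using fst snd by (auto simp: mem_Times_iff)
  then show "finite (parcs (Gamma n))" using fin finite_subset by blast
  show "symmetric (Gamma n)"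
    by (auto simp: symmetric_def sym_def Gamma_def cayley_graph_def insert_commute)
  show "fst e \<noteq> snd e" if e: "e \<in> parcs (Gamma n)" for e
  proof
    assume eq: "fst e = snd e"
    have ends: "fst e permutes {1..n}" "inv' (fst e) \<circ> snd e \<in> {swap12, rot n, rot_inv n}"
      using e arc_iff[of "fst e" "snd e"] by simp_all
    have "id \<in> {swap12, rot n, rot_inv n}"
      using ends(2) unfolding eq[symmetric] permutes_inv_o(2)[OF ends(1)] .
    moreover have "swap12 1 \<noteq> 1" by (simp add: swap12_eq)
    moreover have "rot n 1 \<noteq> 1" "rot_inv n 1 \<noteq> 1" using n by (simp_all add: rot_apply rot_inv_apply)
    ultimately show False by (metis id_apply insertE singletonD)
  qed
qed

interpretation pair_graph "Gamma n" by (rule pair_graph_Gamma)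

lemma reachable_Gamma:
  assumes "g permutes {1..n}" "h permutes {1..n}"
  shows "g \<rightarrow>\<^sup>*\<^bsub>Gamma n\<^esub> h"
proof -
  define M where
    "M = {s. s permutes {1..n} \<and> (\<forall>g. g permutes {1..n} \<longrightarrow> g \<rightarrow>\<^sup>*\<^bsub>Gamma n\<^esub> (g \<circ> s))}"
  have gen: "s \<in> M" if "s \<in> {swap12, rot n, rot_inv n}" for s
  proof -
    have s: "s permutes {1..n}"
      using that swap12_permutes rot_permutes rot_inv_permutes n by auto
    moreover have "g \<rightarrow>\<^bsub>Gamma n\<^esub> (g \<circ> s)" if g: "g permutes {1..n}" for g
    proof -
      have "inv' g \<circ> (g \<circ> s) = s" using g by (simp add: comp_assoc[symmetric] permutes_inv_o(2))
      then have "(g, g \<circ> s) \<in> parcs (Gamma n)"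
        using g s \<open>s \<in> _\<close> by (simp add: arc_iff permutes_compose)
      then show ?thesis by simp
    qed
    ultimately show ?thesis by (auto simp: M_def)
  qed
  have comp: "s \<circ> t \<in> M" if "s \<in> M" "t \<in> M" for s t
  proof -
    have "g \<rightarrow>\<^sup>*\<^bsub>Gamma n\<^esub> (g \<circ> (s \<circ> t))" if g: "g permutes {1..n}" for g
    proof -
      have "g \<rightarrow>\<^sup>*\<^bsub>Gamma n\<^esub> (g \<circ> s)" using g \<open>s \<in> M\<close> by (simp add: M_def)
      moreover have "g \<circ> s permutes {1..n}" using g \<open>s \<in> M\<close> by (simp add: M_def permutes_compose)
      then have "(g \<circ> s) \<rightarrow>\<^sup>*\<^bsub>Gamma n\<^esub> (g \<circ> s \<circ> t)" using \<open>t \<in> M\<close> by (simp add: M_def)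
      ultimately show ?thesis by (metis comp_assoc reachable_trans)
    qed
    then show ?thesis using that by (simp add: M_def permutes_compose)
  qed
  have adj: "transpose i (Suc i) \<in> M" if "1 \<le> i" "i < n" for i
    using that
  proof (induction i rule: nat_induct_at_least)
    case base
    have "transpose 1 (Suc 1) = swap12" by (simp add: swap12_eq numeral_2_eq_2)
    then show ?case using gen by simp
  next
    case (Suc i)
    have "rot n \<circ> transpose i (Suc i) \<circ> inv' (rot n) = transpose (rot n i) (rot n (Suc i))"
      using conjugation_of_cycle[of "[i, Suc i]" "rot n"] permutes_bij[OF rot_permutes] by simp
    also have "\<dots> = transpose (Suc i) (Suc (Suc i))" using Suc.hyps Suc.prems by (simp add: rot_apply)
    finally have "rot n \<circ> transpose i (Suc i) \<circ> inv' (rot n) = transpose (Suc i) (Suc (Suc i))" .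
    moreover have "rot_inv n = inv' (rot n)" using n by (simp add: rot_inv_eq)
    ultimately show ?case using comp[OF comp[OF gen[of "rot n"] Suc.IH] gen[of "rot_inv n"]] Suc.prems
      by simp
  qed
  have upward: "Suc i \<le> j \<longrightarrow> 1 \<le> i \<longrightarrow> j \<le> n \<longrightarrow> transpose i j \<in> M" for i j
  proof (induction j)
    case 0
    then show ?case by simp
  next
    case (Suc j)
    show ?case
    proof (intro impI)
      assume a: "Suc i \<le> Suc j" "1 \<le> i" "Suc j \<le> n"
      show "transpose i (Suc j) \<in> M"
      proof (cases "i = j")
        case True
        then show ?thesis using adj a by simp
      next
        case False
        then have "transpose i (Suc j) =
            transpose j (Suc j) \<circ> transpose i j \<circ> transpose j (Suc j)"
          using a by (auto simp: fun_eq_iff transpose_def)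
        moreover have "transpose i j \<in> M" "transpose j (Suc j) \<in> M"
          using Suc adj a False by auto
        ultimately show ?thesis using comp by simp
      qed
    qed
  qed
  have id_M: "id \<in> M" using comp[of swap12 swap12] gen[of swap12] by (simp add: swap12_eq)
  have transp: "transpose i j \<in> M" if "i \<in> {1..n}" "j \<in> {1..n}" for i j
  proof (cases i j rule: linorder_cases)
    case less
    then show ?thesis using upward[of i j] that by simp
  next
    case equal
    then show ?thesis using id_M by simp
  next
    case greater
    then show ?thesis using upward[of j i] that by (simp add: transpose_commute)
  qed
  have all: "p \<in> M" if "p permutes {1..n}" for p
    using that finite_atLeastAtMost
  proof (induction p rule: permutes_induct)
    case id
    then show ?case using id_M by (simp add: id_def)
  next
    case (swap a b p)
    show ?case using swap.hyps swap.IH by (intro comp transp) auto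
  qed
  have "inv' g \<circ> h \<in> M" using all assms by (simp add: permutes_compose permutes_inv)
  then have "g \<rightarrow>\<^sup>*\<^bsub>Gamma n\<^esub> (g \<circ> (inv' g \<circ> h))" using assms by (simp add: M_def)
  then show ?thesis using assms by (simp add: comp_assoc[symmetric] permutes_inv_o(1))
qed

lemma dist_graph_Gamma_finite:
  assumes "g \<in> pverts (Gamma n)" "h \<in> pverts (Gamma n)"
  shows "dist_graph (Gamma n) g h < \<infinity>"
proof -
  have "g \<rightarrow>\<^sup>*\<^bsub>Gamma n\<^esub> h"
    using assms reachable_Gamma by (simp add: Gamma_def cayley_graph_def sym_group_carrier)
  then obtain p where "awalk g p h" by (auto simp: reachable_awalk)
  then show ?thesis unfolding dist_graph_def
    by (meson ereal_infty_less(1) min_cost_le_walk_cost order_le_less_trans less_ereal.simps(4) ereal_less_PInfty)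
qed

end

end

theory Submission
  imports Defs
begin

text \<open>
  The vertex at distance at least n(n-1)/2 from the identity is the reflection that sends a
  to 3 - a modulo n. A walk to it consists of transpositions and rotations, counted separately.

  Transpositions: each one reverses the cyclic orientation of the triples that contain the two
  swapped labels, and the reflection reverses every triple. Hence the pairs swapped an odd number of
  times form two disjoint cliques covering all labels, so there are at least
  s(s-1)/2 + (n-s)(n-s-1)/2 transpositions, where s is the size of one clique. For even n, moreover,
  s has the parity of the number of rotations.

  Rotations: merge the places 1 and 2 of the circle into one, and let a pointer record the total
  rotation. In the resulting circle with n - 1 places a transposition moves no label and a rotation
  moves exactly one label by one place. The sum of the initial and the final place of a label does
  not depend on the label, so stopping at any intermediate time and applying the triangle inequality
  to each label gives a lower bound that depends only on the pointer at that time. The pointer covers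
  a range of length at least n - 3, because otherwise two neighbouring labels would never move, and
  hence the time can be chosen such that the bound is as good as needed.
\<close>

subsection \<open>Distance to the multiples of an integer\<close>

definition circ_norm :: "int \<Rightarrow> int \<Rightarrow> int" where
  "circ_norm N z = min (z mod N) (N - z mod N)"

lemma circ_norm_cong: "y mod N = z mod N \<Longrightarrow> circ_norm N y = circ_norm N z"
  by (simp add: circ_norm_def)

text \<open>With \<open>circ_norm_eq_abs\<close> this makes \<open>circ_norm N z\<close> the minimum
  of |z - N * k| over all k, the form from which the triangle inequality follows.\<close>

lemma circ_norm_le_abs:
  assumes "N > 0"
  shows "circ_norm N z \<le> \<bar>z - N * k\<bar>"
proof -
  have z: "z - N * k = z mod N + N * (z div N - k)"
    by (simp add: algebra_simps)
  have r: "0 \<le> z mod N" "z mod N < N" using assms by simp_all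
  show ?thesis
  proof (cases "k \<le> z div N")
    case True
    then have "0 \<le> N * (z div N - k)" using assms by simp
    then show ?thesis using z r by (simp add: circ_norm_def)
  next
    case False
    then have "N * (z div N - k) \<le> N * (-1)" using assms by (intro mult_left_mono) auto
    then show ?thesis using z r unfolding circ_norm_def by linarith
  qed
qed

lemma circ_norm_eq_abs:
  assumes "N > 0"
  obtains k where "circ_norm N z = \<bar>z - N * k\<bar>"
proof -
  have z: "z = z mod N + N * (z div N)" by simp
  have r: "0 \<le> z mod N" "z mod N < N" using assms by simp_all
  show ?thesis
  proof (cases "z mod N \<le> N - z mod N")
    case True
    then show ?thesis using that[of "z div N"] z r unfolding circ_norm_def by linarith
  next
    case False
    then show ?thesis using that[of "z div N + 1"] z r unfolding circ_norm_def
      by (simp add: algebra_simps)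
  qed
qed

lemma circ_norm_add_le:
  assumes "N > 0"
  shows "circ_norm N (y + z) \<le> circ_norm N y + circ_norm N z"
proof -
  obtain j k where "circ_norm N y = \<bar>y - N * j\<bar>" "circ_norm N z = \<bar>z - N * k\<bar>"
    using circ_norm_eq_abs[OF assms] by metis
  moreover have "circ_norm N (y + z) \<le> \<bar>(y + z) - N * (j + k)\<bar>"
    by (rule circ_norm_le_abs[OF assms])
  moreover have "(y + z) - N * (j + k) = (y - N * j) + (z - N * k)" by (simp add: algebra_simps)
  ultimately show ?thesis by linarith
qed

lemma circ_norm_minus:
  assumes "N > 0"
  shows "circ_norm N (- z) = circ_norm N z"
proof -
  have "circ_norm N (- y) \<le> circ_norm N y" for y
  proof -
    obtain j where "circ_norm N y = \<bar>y - N * j\<bar>" using circ_norm_eq_abs[OF assms] by metis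
    moreover have "circ_norm N (- y) \<le> \<bar>- y - N * (- j)\<bar>" by (rule circ_norm_le_abs[OF assms])
    ultimately show ?thesis by simp
  qed
  from this[of z] this[of "- z"] show ?thesis by simp
qed

lemma circ_norm_le_sum:
  fixes w :: "nat \<Rightarrow> int"
  assumes "N > 0" "i \<le> j"
  shows "circ_norm N (w j - w i) \<le> (\<Sum>t=i..<j. circ_norm N (w (Suc t) - w t))"
  using \<open>i \<le> j\<close>
proof (induction j rule: dec_induct)
  case base
  then show ?case using assms by (simp add: circ_norm_def)
next
  case (step j)
  have "circ_norm N (w (Suc j) - w i) \<le> circ_norm N (w (Suc j) - w j) + circ_norm N (w j - w i)"
    using circ_norm_add_le[OF assms(1), of "w (Suc j) - w j" "w j - w i"] by simp
  then show ?case using step by simp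
qed

section \<open>Sums of circular distances\<close>

definition min_sum :: "nat \<Rightarrow> int" where
  "min_sum k = (\<Sum>r<k. min (int r) (int k - int r))"

lemma min_sum_Suc_Suc: "min_sum (Suc (Suc k)) = min_sum k + int k + 1"
proof -
  have "min_sum (Suc (Suc k)) = (\<Sum>r<Suc k. min (int (Suc r)) (int (Suc (Suc k)) - int (Suc r)))"
    unfolding min_sum_def by (subst sum.lessThan_Suc_shift) simp
  also have "\<dots> = (\<Sum>r<Suc k. 1 + min (int r) (int k - int r))"
    by (intro sum.cong) auto
  also have "\<dots> = min_sum k + int k + 1"
    by (simp add: sum.distrib min_sum_def)
  finally show ?thesis .
qed

lemma min_sum_even: "min_sum (2 * k) = int k ^ 2"
  by (induction k) (simp_all add: min_sum_Suc_Suc min_sum_def[of 0] power2_eq_square algebra_simps)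

lemma min_sum_odd: "min_sum (Suc (2 * k)) = int k * (int k + 1)"
  by (induction k) (simp_all add: min_sum_Suc_Suc min_sum_def[of "Suc 0"] algebra_simps)

text \<open>In the bound on rotations each label enters with twice its place; letting the place run
  once around the circle gives a progression of step 2.\<close>

definition step2_sum :: "nat \<Rightarrow> int \<Rightarrow> int" where
  "step2_sum N z = (\<Sum>r<N. circ_norm (int N) (z + 2 * int r))"

text \<open>The shift trades term 0 for term N, and these are congruent modulo N.\<close>

lemma step2_sum_add_2: "step2_sum N (z + 2) = step2_sum N z"
proof -
  let ?f = "\<lambda>r. circ_norm (int N) (z + 2 * int r)"
  have "step2_sum N (z + 2) + ?f 0 = (\<Sum>r<N. ?f (Suc r)) + ?f 0"
    unfolding step2_sum_def by (simp add: algebra_simps)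
  also have "\<dots> = (\<Sum>r<Suc N. ?f r)" by (subst sum.lessThan_Suc_shift) simp
  also have "\<dots> = step2_sum N z + ?f N" by (simp add: step2_sum_def)
  also have "?f N = ?f 0" by (intro circ_norm_cong) simp
  finally show ?thesis by simp
qed

lemma step2_sum_cong:
  assumes "even (y - z)"
  shows "step2_sum N y = step2_sum N z"
proof -
  have nat: "step2_sum N (z + 2 * int k) = step2_sum N z" for z k
    by (induction k) (use step2_sum_add_2[of N "z + 2 * int _"] in \<open>auto simp: algebra_simps\<close>)
  obtain k where k: "y - z = 2 * k" using assms by blast
  show ?thesis
  proof (cases "k \<ge> 0")
    case True
    then show ?thesis using nat[of z "nat k"] k by (simp add: algebra_simps)
  next
    case False
    then show ?thesis using nat[of y "nat (- k)"] k by (simp add: algebra_simps)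
  qed
qed

lemma sum_lessThan_add:
  fixes f :: "nat \<Rightarrow> int"
  shows "(\<Sum>r<k + j. f r) = (\<Sum>r<k. f r) + (\<Sum>r<j. f (k + r))"
  by (induction j) simp_all

lemma circ_norm_sum: "(\<Sum>r<N. circ_norm (int N) (int r)) = min_sum N"
  unfolding min_sum_def circ_norm_def by (intro sum.cong) auto

text \<open>The two progressions interleave to 0, ..., 2N - 1, which meets every residue modulo N
  twice.\<close>

lemma step2_sum_0_1: "step2_sum N 0 + step2_sum N 1 = 2 * min_sum N"
proof -
  have "(\<Sum>r<2 * k. circ_norm (int N) (int r)) =
      (\<Sum>r<k. circ_norm (int N) (0 + 2 * int r)) + (\<Sum>r<k. circ_norm (int N) (1 + 2 * int r))" for k
    by (induction k) (simp_all add: algebra_simps)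
  from this[of N] have "step2_sum N 0 + step2_sum N 1 = (\<Sum>r<2 * N. circ_norm (int N) (int r))"
    by (simp add: step2_sum_def)
  also have "\<dots> = (\<Sum>r<N. circ_norm (int N) (int r)) + (\<Sum>r<N. circ_norm (int N) (int (N + r)))"
    by (simp only: mult_2 sum_lessThan_add)
  also have "(\<Sum>r<N. circ_norm (int N) (int (N + r))) = (\<Sum>r<N. circ_norm (int N) (int r))"
    by (intro sum.cong circ_norm_cong) simp_all
  finally show ?thesis using circ_norm_sum by simp
qed

text \<open>The starting points 0 and N are congruent modulo N but of opposite parity, so the two
  sums in \<open>step2_sum_0_1\<close> are equal.\<close>

lemma step2_sum_odd:
  assumes "odd N"
  shows "step2_sum N z = min_sum N"
proof -
  have shift: "step2_sum N (int N) = step2_sum N 0"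
    unfolding step2_sum_def by (intro sum.cong circ_norm_cong) simp_all
  have "step2_sum N (int N) = step2_sum N 1" using assms by (intro step2_sum_cong) auto
  then have "step2_sum N 0 = min_sum N" "step2_sum N 1 = min_sum N"
    using shift step2_sum_0_1[of N] by simp_all
  then show ?thesis
    using step2_sum_cong[of z 0 N] step2_sum_cong[of z 1 N] by (cases "even z") auto
qed

lemma step2_sum_even_0: "step2_sum (2 * m) 0 = 4 * min_sum m"
proof -
  let ?f = "\<lambda>r. circ_norm (int (2 * m)) (2 * int r)"
  have f: "?f r = 2 * min (int r) (int m - int r)" if "r < m" for r
    using that by (simp add: circ_norm_def min_def)
  have g: "?f (m + r) = ?f r" for r
    by (intro circ_norm_cong) (simp add: algebra_simps)
  have "step2_sum (2 * m) 0 = (\<Sum>r<m. ?f r) + (\<Sum>r<m. ?f (m + r))"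
    by (simp only: step2_sum_def mult_2[of m] sum_lessThan_add add_0)
  also have "\<dots> = 2 * (\<Sum>r<m. ?f r)" by (simp only: g)
  also have "(\<Sum>r<m. ?f r) = 2 * min_sum m"
    unfolding min_sum_def sum_distrib_left by (intro sum.cong f) auto
  finally show ?thesis by simp
qed

text \<open>
  The trajectory of a walk: x t a is the position of label a after t steps, and d t is the
  displacement of the pointer (the place where the transposition acts) in step t.
\<close>

locale lrx_walk =
  fixes n L :: nat and x :: "nat \<Rightarrow> nat \<Rightarrow> nat" and d :: "nat \<Rightarrow> int"
  assumes n_ge: "n \<ge> 4"
    and bij: "t \<le> L \<Longrightarrow> bij_betw (x t) {1..n} {1..n}"
    and start: "a \<in> {1..n} \<Longrightarrow> x 0 a = a"
    and finish: "a \<in> {1..n} \<Longrightarrow> x L a = (if a \<le> 2 then 3 - a else n + 3 - a)"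
    and step: "t < L \<Longrightarrow>
      d t = 0 \<and> (\<forall>a\<in>{1..n}. x (Suc t) a = transpose 1 2 (x t a)) \<or>
      d t = 1 \<and> (\<forall>a\<in>{1..n}. x (Suc t) a = (if x t a = 1 then n else x t a - 1)) \<or>
      d t = -1 \<and> (\<forall>a\<in>{1..n}. x (Suc t) a = (if x t a = n then 1 else Suc (x t a)))"
begin

lemma x_range: "t \<le> L \<Longrightarrow> a \<in> {1..n} \<Longrightarrow> 1 \<le> x t a \<and> x t a \<le> n"
  using bij_betwE[OF bij] by fastforce

lemma x_inj: "t \<le> L \<Longrightarrow> a \<in> {1..n} \<Longrightarrow> b \<in> {1..n} \<Longrightarrow> x t a = x t b \<longleftrightarrow> a = b"
  by (rule inj_on_eq_iff[OF bij_betw_imp_inj_on[OF bij]])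

lemma x_surj:
  assumes "t \<le> L" "i \<in> {1..n}" obtains a where "a \<in> {1..n}" "x t a = i"
proof -
  have "i \<in> x t ` {1..n}" using bij[OF assms(1)] assms(2) unfolding bij_betw_def by simp
  then show ?thesis using that by blast
qed

lemma d_cases: "t < L \<Longrightarrow> d t = 0 \<or> d t = 1 \<or> d t = -1"
  using step[of t] by argo

definition swaps :: "nat set" where
  "swaps = {t. t < L \<and> d t = 0}"

definition pointer :: "nat \<Rightarrow> int" where
  "pointer t = (\<Sum>i<t. d i)"

definition rotations :: "nat \<Rightarrow> nat \<Rightarrow> int" where
  "rotations i j = (\<Sum>t=i..<j. \<bar>d t\<bar>)"

lemma pointer_Suc: "pointer (Suc t) = pointer t + d t"
  by (simp add: pointer_def)

lemma length_split: "int L = int (card swaps) + rotations 0 L"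
proof -
  have "int L = (\<Sum>t=0..<L. (if d t = 0 then 1 else 0) + \<bar>d t\<bar>)"
  proof -
    have "(if d t = 0 then 1 else 0) + \<bar>d t\<bar> = 1" if "t < L" for t
      using d_cases[OF that] by auto
    then have "(\<Sum>t=0..<L. (if d t = 0 then 1 else 0) + \<bar>d t\<bar>) = (\<Sum>t=0..<L. 1)"
      by (intro sum.cong) auto
    then show ?thesis by simp
  qed
  also have "\<dots> = (\<Sum>t=0..<L. if d t = 0 then 1 else 0) + rotations 0 L"
    by (simp add: sum.distrib rotations_def)
  also have "(\<Sum>t=0..<L. if d t = 0 then 1 else 0) = int (card swaps)"
    by (subst sum.inter_filter[symmetric]) (auto simp: swaps_def intro!: arg_cong[of _ _ card])
  finally show ?thesis .
qed

subsection \<open>Positions on the circle with the first two places merged\<close>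

definition merged :: "nat \<Rightarrow> int" where
  "merged i = (if i = 1 then 0 else int i - 2)"

lemma merged_eq: "i \<ge> 1 \<Longrightarrow> merged i = int (i - 2)"
  by (auto simp: merged_def)

definition place :: "nat \<Rightarrow> nat \<Rightarrow> int" where
  "place a t = pointer t + merged (x t a)"

text \<open>A rotation shifts positions against the pointer, so a place changes only where
  \<open>merged\<close> does not follow the shift, between positions 1 and 2. Wrapping between 1 and
  n contributes n - 1, hence the congruence.\<close>

lemma place_step:
  assumes "t < L" "a \<in> {1..n}"
  shows "(place a (Suc t) - place a t) mod (int n - 1) =
    (if d t = 1 \<and> x t a = 2 then 1 else if d t = -1 \<and> x t a = 1 then -1 else 0) mod (int n - 1)"
proof -
  have r: "1 \<le> x t a" "x t a \<le> n" using x_range[of t a] assms by auto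
  have n: "n \<ge> 4" by (rule n_ge)
  have wrap: "(int n - 1) mod (int n - 1) = 0 mod (int n - 1)" "(1 - int n) mod (int n - 1) = 0 mod (int n - 1)"
    using mod_minus_eq[of "int n - 1" "int n - 1"] by auto
  consider (X) "d t = 0" "x (Suc t) a = transpose 1 2 (x t a)"
    | (R) "d t = 1" "x (Suc t) a = (if x t a = 1 then n else x t a - 1)"
    | (L) "d t = -1" "x (Suc t) a = (if x t a = n then 1 else Suc (x t a))"
    using step[OF assms(1)] assms(2) by blast
  then show ?thesis
  proof cases
    case X
    then have "place a (Suc t) - place a t = 0"
      using r by (auto simp: place_def pointer_Suc merged_def transpose_def)
    then show ?thesis using X by simp
  next
    case R
    then have "place a (Suc t) - place a t = (if x t a = 1 then int n - 1 else if x t a = 2 then 1 else 0)"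
      using r n by (auto simp: place_def pointer_Suc merged_def)
    then show ?thesis using R wrap by auto
  next
    case L
    then have "place a (Suc t) - place a t = (if x t a = n then 1 - int n else if x t a = 1 then -1 else 0)"
      using r n by (auto simp: place_def pointer_Suc merged_def)
    then show ?thesis using L wrap n by auto
  qed
qed

lemma circ_norm_place_step:
  assumes "t < L"
  shows "(\<Sum>a\<in>{1..n}. circ_norm (int n - 1) (place a (Suc t) - place a t)) \<le> \<bar>d t\<bar>"
proof -
  have n: "n \<ge> 4" by (rule n_ge)
  have one: "circ_norm (int n - 1) 0 = 0" "circ_norm (int n - 1) 1 = 1" "circ_norm (int n - 1) (-1) = 1"
    using n circ_norm_minus[of "int n - 1" 1] by (auto simp: circ_norm_def)
  obtain c1 where c1: "c1 \<in> {1..n}" "x t c1 = 1" using x_surj[of t 1] assms n by auto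
  obtain c2 where c2: "c2 \<in> {1..n}" "x t c2 = 2" using x_surj[of t 2] assms n by auto
  \<comment> \<open>The only label that can move: it passes from position 2 to 1 if d t = 1 and from
    1 to 2 if d t = -1. For d t = 0 the choice does not matter.\<close>
  define c where "c = (if d t = 1 then c2 else c1)"
  have c: "c \<in> {1..n}" using c1 c2 by (simp add: c_def)
  have "circ_norm (int n - 1) (place a (Suc t) - place a t) = (if a = c then \<bar>d t\<bar> else 0)"
    if a: "a \<in> {1..n}" for a
  proof -
    have "x t a = 1 \<longleftrightarrow> a = c1" "x t a = 2 \<longleftrightarrow> a = c2"
      using x_inj[of t a] a c1 c2 assms by (metis less_imp_le)+
    then show ?thesis
      using circ_norm_cong[OF place_step[OF assms a]] one d_cases[OF assms] by (auto simp: c_def)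
  qed
  then have "(\<Sum>a\<in>{1..n}. circ_norm (int n - 1) (place a (Suc t) - place a t)) =
      (\<Sum>a\<in>{1..n}. if a = c then \<bar>d t\<bar> else 0)"
    by (intro sum.cong) auto
  then show ?thesis using c by simp
qed

lemma rotations_ge:
  assumes "i \<le> j" "j \<le> L"
  shows "rotations i j \<ge> (\<Sum>a\<in>{1..n}. circ_norm (int n - 1) (place a j - place a i))"
proof -
  have "(\<Sum>a\<in>{1..n}. circ_norm (int n - 1) (place a j - place a i)) \<le>
      (\<Sum>a\<in>{1..n}. \<Sum>t=i..<j. circ_norm (int n - 1) (place a (Suc t) - place a t))"
  proof (rule sum_mono)
    fix a
    show "circ_norm (int n - 1) (place a j - place a i) \<le>
        (\<Sum>t=i..<j. circ_norm (int n - 1) (place a (Suc t) - place a t))"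
      using assms n_ge by (intro circ_norm_le_sum[of _ i j "place a"]) auto
  qed
  also have "\<dots> = (\<Sum>t=i..<j. \<Sum>a\<in>{1..n}. circ_norm (int n - 1) (place a (Suc t) - place a t))"
    by (rule sum.swap)
  also have "\<dots> \<le> rotations i j"
    unfolding rotations_def using assms by (intro sum_mono circ_norm_place_step) auto
  finally show ?thesis .
qed

lemma place_start_finish:
  assumes "a \<in> {1..n}"
  shows "place a 0 + place a L = pointer L + (if a \<le> 2 then 0 else int n - 1)"
  using assms n_ge start[OF assms] finish[OF assms]
  by (auto simp: place_def merged_def pointer_def)

text \<open>
  A label that is at the places u and v when the pointer crosses has been moved from its initial
  place to u and is still to be moved from v to its final place; since the sum of the initial and
  final places does not depend on the label, these distances add up to a bound in which the
  arrangement of the labels at that time is irrelevant.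
\<close>

lemma rotations_ge_crossing:
  assumes T: "T < L" and cross: "{pointer T, pointer (Suc T)} = {v, v + 1}"
  shows "rotations 0 L \<ge> step2_sum (n - 1) (pointer L) + 1 + circ_norm (int n - 1) (2 * v + 1 - pointer L)"
proof -
  let ?N = "int n - 1" and ?p = "pointer L"
  have N: "?N > 0" "int (n - 1) = ?N" using n_ge by auto
  have d: "pointer T = v \<and> d T = 1 \<or> pointer T = v + 1 \<and> d T = -1"
    using cross pointer_Suc[of T] d_cases[OF T] by (auto simp: doubleton_eq_iff)
  \<comment> \<open>The displacement before the crossing minus the one after it;
    \<open>place_start_finish\<close> eliminates the end places modulo n - 1.\<close>
  define h where "h a = circ_norm ?N (place a T + place a (Suc T) - ?p)" for a
  have split: "rotations 0 L = rotations 0 T + 1 + rotations (Suc T) L"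
  proof -
    have "{0..<L} = {0..<T} \<union> {T} \<union> {Suc T..<L}" using T by auto
    then have "rotations 0 L = (\<Sum>t\<in>{0..<T} \<union> {T} \<union> {Suc T..<L}. \<bar>d t\<bar>)"
      by (simp add: rotations_def)
    also have "\<dots> = rotations 0 T + \<bar>d T\<bar> + rotations (Suc T) L"
      unfolding rotations_def by (subst sum.union_disjoint; simp add: sum.union_disjoint)+
    finally show ?thesis using d by auto
  qed
  have h_le: "h a \<le> circ_norm ?N (place a T - place a 0) + circ_norm ?N (place a L - place a (Suc T))"
    if a: "a \<in> {1..n}" for a
  proof -
    have "(place a T + place a (Suc T) - ?p) mod ?N =
        ((place a T - place a 0) + - (place a L - place a (Suc T))) mod ?N"
    proof -
      have "(place a T - place a 0) + - (place a L - place a (Suc T)) =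
          place a T + place a (Suc T) - ?p - (if a \<le> 2 then 0 else ?N)"
        using place_start_finish[OF a] by simp
      then show ?thesis by (simp only:) auto
    qed
    then have "h a = circ_norm ?N ((place a T - place a 0) + - (place a L - place a (Suc T)))"
      unfolding h_def by (rule circ_norm_cong)
    then show ?thesis
      using circ_norm_add_le[OF N(1)] circ_norm_minus[OF N(1)] by metis
  qed
  \<comment> \<open>The position of the label that moves in step T. Modulo n - 1 its places before
    and after are v and v + 1 in some order, which explains 2 * v + 1 in \<open>k\<close>.\<close>
  let ?s = "if d T = 1 then 2 else 1"
  define k where "k i = (if i = ?s then circ_norm ?N (2 * v + 1 - ?p)
      else circ_norm ?N (2 * pointer T + 2 * merged i - ?p))" for i
  have h_eq: "h a = k (x T a)" if a: "a \<in> {1..n}" for a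
  proof -
    have "(place a T + place a (Suc T) - ?p) mod ?N =
        ((2 * place a T - ?p) + (place a (Suc T) - place a T)) mod ?N"
      by (simp add: algebra_simps)
    also have "\<dots> = ((2 * place a T - ?p) + (if x T a = ?s then d T else 0)) mod ?N"
      using place_step[OF T a] d by (intro mod_add_cong) auto
    finally have "h a = circ_norm ?N ((2 * place a T - ?p) + (if x T a = ?s then d T else 0))"
      unfolding h_def by (rule circ_norm_cong)
    then show ?thesis
      using d by (auto simp: k_def place_def merged_def algebra_simps)
  qed
  have "rotations 0 L \<ge> (\<Sum>a\<in>{1..n}. circ_norm ?N (place a T - place a 0)) + 1
      + (\<Sum>a\<in>{1..n}. circ_norm ?N (place a L - place a (Suc T)))"
    using rotations_ge[of 0 T] rotations_ge[of "Suc T" L] split T by simp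
  moreover have "(\<Sum>a\<in>{1..n}. h a) \<le> (\<Sum>a\<in>{1..n}. circ_norm ?N (place a T - place a 0))
      + (\<Sum>a\<in>{1..n}. circ_norm ?N (place a L - place a (Suc T)))"
    unfolding sum.distrib[symmetric] by (intro sum_mono h_le)
  moreover have "(\<Sum>a\<in>{1..n}. h a) = (\<Sum>i\<in>{1..n}. k i)"
  proof -
    have "(\<Sum>a\<in>{1..n}. h a) = (\<Sum>a\<in>{1..n}. k (x T a))" using h_eq by (intro sum.cong) auto
    also have "\<dots> = (\<Sum>i\<in>{1..n}. k i)"
      using bij[of T] T by (intro sum.reindex_bij_betw) auto
    finally show ?thesis .
  qed
  moreover have "(\<Sum>i\<in>{1..n}. k i) =
      circ_norm ?N (2 * v + 1 - ?p) + step2_sum (n - 1) (2 * pointer T - ?p)"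
  proof -
    have s: "?s \<in> {1..n}" using n_ge by auto
    have "(\<Sum>i\<in>{1..n}. k i) = k ?s + (\<Sum>i\<in>{1..n} - {?s}. k i)"
      using s by (intro sum.remove) auto
    \<comment> \<open>Without position \<open>?s\<close> every merged place occurs exactly once.
      Place 0 is represented by 3 - \<open>?s\<close>, which truncated subtraction of 2 sends to
      0.\<close>
    also have "(\<Sum>i\<in>{1..n} - {?s}. k i) = (\<Sum>r<n - 1. circ_norm ?N ((2 * pointer T - ?p) + 2 * int r))"
      by (rule sum.reindex_bij_witness[where i = "\<lambda>r. if r = 0 then 3 - ?s else r + 2"
            and j = "\<lambda>i. i - 2"])
        (use n_ge in \<open>auto simp: k_def merged_eq algebra_simps\<close>)
    finally show ?thesis by (simp add: k_def step2_sum_def N(2))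
  qed
  moreover have "step2_sum (n - 1) (2 * pointer T - ?p) = step2_sum (n - 1) ?p"
    by (rule step2_sum_cong) simp
  ultimately show ?thesis by linarith
qed

end

text \<open>If no step joined v and v + 1, the truth value of f t \<le> v would be the same at all
  times up to L.\<close>

lemma discrete_crossing:
  fixes f :: "nat \<Rightarrow> int"
  assumes step: "\<And>t. t < L \<Longrightarrow> \<bar>f (Suc t) - f t\<bar> \<le> 1"
    and ij: "i \<le> L" "j \<le> L" "f i \<le> v" "v < f j"
  obtains t where "t < L" "{f t, f (Suc t)} = {v, v + 1}"
proof (rule ccontr)
  assume none: "\<not> thesis"
  note crossing = that
  have "f t \<le> v \<longleftrightarrow> f (Suc t) \<le> v" if "t < L" for t
  proof -
    have "{f t, f (Suc t)} \<noteq> {v, v + 1}" using none crossing[OF \<open>t < L\<close>] by metis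
    then show ?thesis using step[OF that] by (auto simp: doubleton_eq_iff)
  qed
  then have "f t \<le> v \<longleftrightarrow> f 0 \<le> v" if "t \<le> L" for t
    using that by (induction t) auto
  from this[OF ij(1)] this[OF ij(2)] show False using ij by linarith
qed

section \<open>Cyclic orientation of triples\<close>

definition pair_sign :: "nat \<Rightarrow> nat \<Rightarrow> int" where
  "pair_sign i j = (if i < j then 1 else -1)"

definition orientation :: "nat \<Rightarrow> nat \<Rightarrow> nat \<Rightarrow> int" where
  "orientation i j k = pair_sign i j * pair_sign j k * pair_sign k i"

lemma pair_sign_transpose:
  assumes "u \<noteq> v" "u \<ge> 1" "v \<ge> 1"
  shows "pair_sign (transpose 1 2 u) (transpose 1 2 v) =
    pair_sign u v * (if {u, v} = {1, 2} then -1 else 1)"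
proof -
  have "u = 1 \<or> u = 2 \<or> u > 2" "v = 1 \<or> v = 2 \<or> v > 2" using assms by linarith+
  then show ?thesis
    using assms(1) by (elim disjE) (simp_all add: pair_sign_def transpose_def doubleton_eq_iff)
qed

text \<open>The correction is a product of one factor per label, the form that cancels around a
  triple in \<open>orientation_coboundary\<close>.\<close>

lemma pair_sign_rotate:
  assumes "u \<noteq> v" "1 \<le> u" "u \<le> n" "1 \<le> v" "v \<le> n"
  shows "pair_sign (if u = 1 then n else u - 1) (if v = 1 then n else v - 1) =
    pair_sign u v * ((if u = 1 then -1 else 1) * (if v = 1 then -1 else 1))"
  using assms by (auto simp: pair_sign_def)

lemma pair_sign_rotate_inv:
  assumes "u \<noteq> v" "1 \<le> u" "u \<le> n" "1 \<le> v" "v \<le> n"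
  shows "pair_sign (if u = n then 1 else Suc u) (if v = n then 1 else Suc v) =
    pair_sign u v * ((if u = n then -1 else 1) * (if v = n then -1 else 1))"
  using assms by (auto simp: pair_sign_def)

lemma pair_sign_reflect:
  assumes "u \<noteq> v" "1 \<le> u" "u \<le> n" "1 \<le> v" "v \<le> n"
  shows "pair_sign (if u \<le> 2 then 3 - u else n + 3 - u) (if v \<le> 2 then 3 - v else n + 3 - v) =
    - pair_sign u v * ((if u \<le> 2 then -1 else 1) * (if v \<le> 2 then -1 else 1))"
  using assms by (auto simp: pair_sign_def)

text \<open>Around the triple each of r, s, t occurs twice and cancels, while e occurs three times
  and e^3 = e.\<close>

lemma orientation_coboundary:
  assumes "pair_sign u' v' = e * pair_sign u v * (r * s)" "pair_sign v' w' = e * pair_sign v w * (s * t)"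
    "pair_sign w' u' = e * pair_sign w u * (t * r)" and "e \<in> {1, -1}" "r \<in> {1, -1}" "s \<in> {1, -1}" "t \<in> {1, -1}"
  shows "orientation u' v' w' = e * orientation u v w"
  unfolding orientation_def assms(1-3) using assms(4-) by auto

context lrx_walk
begin

subsection \<open>Counting transpositions\<close>

definition swapped :: "nat \<Rightarrow> nat \<Rightarrow> nat \<Rightarrow> int" where
  "swapped t a b = (if d t = 0 \<and> {x t a, x t b} = {1, 2} then -1 else 1)"

definition swap_parity :: "nat \<Rightarrow> nat \<Rightarrow> nat \<Rightarrow> int" where
  "swap_parity t a b = (\<Prod>i<t. swapped i a b)"

lemma swap_parity_Suc: "swap_parity (Suc t) a b = swap_parity t a b * swapped t a b"
  by (simp add: swap_parity_def)

lemma swap_parity_cases: "swap_parity t a b = 1 \<or> swap_parity t a b = -1"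
  by (induction t) (auto simp: swap_parity_def swapped_def)

lemma swap_parity_commute: "swap_parity t a b = swap_parity t b a"
  by (simp add: swap_parity_def swapped_def insert_commute)

lemma orientation_step:
  assumes "t < L" "a \<in> {1..n}" "b \<in> {1..n}" "c \<in> {1..n}" "a \<noteq> b" "b \<noteq> c" "c \<noteq> a"
  shows "orientation (x (Suc t) a) (x (Suc t) b) (x (Suc t) c) =
    orientation (x t a) (x t b) (x t c) * (swapped t a b * swapped t b c * swapped t c a)"
proof -
  have r: "1 \<le> x t a" "x t a \<le> n" "1 \<le> x t b" "x t b \<le> n" "1 \<le> x t c" "x t c \<le> n"
    using x_range[of t] assms by auto
  have ne: "x t a \<noteq> x t b" "x t b \<noteq> x t c" "x t c \<noteq> x t a"
    using x_inj[of t] assms by auto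
  consider (X) "d t = 0" "\<forall>a\<in>{1..n}. x (Suc t) a = transpose 1 2 (x t a)"
    | (R) "d t = 1" "\<forall>a\<in>{1..n}. x (Suc t) a = (if x t a = 1 then n else x t a - 1)"
    | (L) "d t = -1" "\<forall>a\<in>{1..n}. x (Suc t) a = (if x t a = n then 1 else Suc (x t a))"
    using step[OF assms(1)] by blast
  then show ?thesis
  proof cases
    case X
    have x: "x (Suc t) a = transpose 1 2 (x t a)" "x (Suc t) b = transpose 1 2 (x t b)"
      "x (Suc t) c = transpose 1 2 (x t c)" using X assms by blast+
    show ?thesis using X(1) r ne
      by (simp only: x orientation_def pair_sign_transpose swapped_def simp_thms mult_ac)
  next
    case R
    have x: "x (Suc t) a = (if x t a = 1 then n else x t a - 1)" "x (Suc t) b = (if x t b = 1 then n else x t b - 1)"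
      "x (Suc t) c = (if x t c = 1 then n else x t c - 1)" using R assms by blast+
    have "orientation (x (Suc t) a) (x (Suc t) b) (x (Suc t) c) = 1 * orientation (x t a) (x t b) (x t c)"
      unfolding x mult_1
      by (rule orientation_coboundary[where e = 1, unfolded mult_1]; (rule pair_sign_rotate)?) (use ne r in auto)
    then show ?thesis using R(1) by (simp add: swapped_def)
  next
    case L
    have x: "x (Suc t) a = (if x t a = n then 1 else Suc (x t a))" "x (Suc t) b = (if x t b = n then 1 else Suc (x t b))"
      "x (Suc t) c = (if x t c = n then 1 else Suc (x t c))" using L assms by blast+
    have "orientation (x (Suc t) a) (x (Suc t) b) (x (Suc t) c) = 1 * orientation (x t a) (x t b) (x t c)"
      unfolding x mult_1
      by (rule orientation_coboundary[where e = 1, unfolded mult_1]; (rule pair_sign_rotate_inv)?) (use ne r in auto)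
    then show ?thesis using L(1) by (simp add: swapped_def)
  qed
qed

lemma orientation_swap_parity:
  assumes "t \<le> L" "a \<in> {1..n}" "b \<in> {1..n}" "c \<in> {1..n}" "a \<noteq> b" "b \<noteq> c" "c \<noteq> a"
  shows "orientation (x t a) (x t b) (x t c) =
    orientation a b c * (swap_parity t a b * swap_parity t b c * swap_parity t c a)"
  using assms(1)
proof (induction t)
  case 0
  then show ?case using assms start by (simp add: swap_parity_def)
next
  case (Suc t)
  then show ?case using orientation_step[of t a b c] assms by (simp add: swap_parity_Suc)
qed

text \<open>The final reflection reverses the orientation of every triple, and only swaps inside the
  triple can reverse it.\<close>

lemma swap_parity_triple:
  assumes "a \<in> {1..n}" "b \<in> {1..n}" "c \<in> {1..n}" "a \<noteq> b" "b \<noteq> c" "c \<noteq> a"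
  shows "swap_parity L a b * swap_parity L b c * swap_parity L c a = -1"
proof -
  have "orientation (x L a) (x L b) (x L c) = - orientation a b c"
    unfolding finish[OF assms(1)] finish[OF assms(2)] finish[OF assms(3)]
    by (rule orientation_coboundary[where e = "-1", unfolded mult_minus1]; (rule pair_sign_reflect)?) (use assms in auto)
  moreover have "orientation a b c = 1 \<or> orientation a b c = -1"
    by (simp add: orientation_def pair_sign_def)
  ultimately show ?thesis using orientation_swap_parity[of L a b c] assms by auto
qed

text \<open>The clique of label 1. Since \<open>swap_parity L 1 1\<close> is 1, label 1 has to be
  added explicitly.\<close>

definition flipped :: "nat set" where
  "flipped = {a \<in> {1..n}. a = 1 \<or> swap_parity L 1 a = -1}"

text \<open>
  The triple condition says that being swapped an even number of times is a complete bipartite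
  relation, so the pairs that are swapped an odd number of times form two disjoint cliques.
\<close>

lemma swap_parity_cliques:
  assumes "a \<in> {1..n}" "b \<in> {1..n}" "a \<noteq> b" "a \<in> flipped \<longleftrightarrow> b \<in> flipped"
  shows "swap_parity L a b = -1"
proof (cases "a = 1 \<or> b = 1")
  case True
  then show ?thesis using assms swap_parity_commute[of L a b] by (auto simp: flipped_def)
next
  case False
  then have "swap_parity L 1 a = swap_parity L 1 b"
    using assms swap_parity_cases[of L 1 a] swap_parity_cases[of L 1 b] by (auto simp: flipped_def)
  then show ?thesis
    using swap_parity_triple[of 1 a b] swap_parity_cases[of L 1 b] swap_parity_commute[of L b 1] assms False n_ge
    by auto
qed

text \<open>A pair inside a clique has odd parity, so it is swapped at least once. Sending each swap
  to the two labels it exchanges therefore covers all these pairs.\<close>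

lemma card_swaps_ge:
  "card swaps \<ge> (card flipped choose 2) + (n - card flipped choose 2)"
proof -
  let ?F = "flipped" and ?G = "{1..n} - flipped"
  let ?P = "\<lambda>A :: nat set. {e. e \<subseteq> A \<and> card e = 2}"
  let ?f = "\<lambda>t. {a \<in> {1..n}. x t a = 1 \<or> x t a = 2}"
  have F: "?F \<subseteq> {1..n}" "finite ?F" by (auto simp: flipped_def)
  have "?P ?F \<union> ?P ?G \<subseteq> ?f ` swaps"
  proof
    fix e assume "e \<in> ?P ?F \<union> ?P ?G"
    then have e: "e \<subseteq> ?F \<or> e \<subseteq> ?G" "card e = 2" by blast+
    then obtain a b where ab: "e = {a, b}" "a \<noteq> b" by (meson card_2_iff)
    then have r: "a \<in> {1..n}" "b \<in> {1..n}" "a \<in> ?F \<longleftrightarrow> b \<in> ?F" using e(1) F(1) by blast+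
    then have "swap_parity L a b = -1" using swap_parity_cliques ab by blast
    then have "(\<Prod>t<L. swapped t a b) \<noteq> 1" by (simp add: swap_parity_def)
    then obtain t where t: "t < L" "swapped t a b \<noteq> 1"
      by (metis lessThan_iff prod.neutral)
    then have sw: "d t = 0" "{x t a, x t b} = {1, 2}"
      unfolding swapped_def by argo+
    have "?f t = {c \<in> {1..n}. x t c \<in> {x t a, x t b}}" unfolding sw(2) by simp
    also have "\<dots> = {a, b}"
    proof -
      have "x t c \<in> {x t a, x t b} \<longleftrightarrow> c \<in> {a, b}" if "c \<in> {1..n}" for c
        using x_inj[of t c a] x_inj[of t c b] r t(1) that by simp
      then show ?thesis using r by blast
    qed
    finally have "?f t = {a, b}" .
    moreover have "t \<in> swaps" using t(1) sw(1) by (simp add: swaps_def)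
    ultimately show "e \<in> ?f ` swaps" using ab(1) by blast
  qed
  moreover have fin: "finite swaps" by (simp add: swaps_def)
  ultimately have "card (?P ?F \<union> ?P ?G) \<le> card (?f ` swaps)"
    by (intro card_mono finite_imageI)
  then have "card (?P ?F \<union> ?P ?G) \<le> card swaps"
    using card_image_le[OF fin, of ?f] by linarith
  moreover have "card (?P ?F \<union> ?P ?G) = card (?P ?F) + card (?P ?G)"
  proof (rule card_Un_disjoint)
    have "?P ?F \<inter> ?P ?G \<subseteq> {e. e \<subseteq> {} \<and> card e = 2}" by blast
    also have "\<dots> = {}" by auto
    finally show "?P ?F \<inter> ?P ?G = {}" by simp
    show "finite (?P ?F)" "finite (?P ?G)"
      using F(2) by (auto intro: finite_subset[of _ "Pow _"])
  qed
  ultimately show ?thesis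
    using F by (simp add: n_subsets card_Diff_subset)
qed

section \<open>Parity of the number of rotations\<close>

text \<open>As n is even, a rotation changes the parity of a position even when it wraps around. A
  transposition changes it for label 1 exactly when label 1 is one of the two swapped
  labels.\<close>

lemma parity_step:
  assumes "even n" "t < L"
  shows "(-1 :: int) ^ x (Suc t) 1 = (-1) ^ x t 1 * (-1) ^ nat \<bar>d t\<bar> * (\<Prod>b\<in>{2..n}. swapped t 1 b)"
proof -
  have one: "1 \<in> {1..n}" using n_ge by auto
  have r: "1 \<le> x t 1" "x t 1 \<le> n" using x_range[of t 1] assms one by auto
  show ?thesis
  proof (cases "d t = 0")
    case False
    then have "swapped t 1 b = 1" for b by (simp add: swapped_def)
    moreover have "x (Suc t) 1 = (if x t 1 = 1 then n else x t 1 - 1) \<or>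
        x (Suc t) 1 = (if x t 1 = n then 1 else Suc (x t 1))"
      using step[OF assms(2)] one False by blast
    then have "even (x (Suc t) 1) \<longleftrightarrow> odd (x t 1)"
      using r assms(1) by (elim disjE) (auto split: if_splits)
    ultimately show ?thesis using d_cases[OF assms(2)] False by (auto simp: minus_one_power_iff)
  next
    case True
    then have x: "x (Suc t) 1 = transpose 1 2 (x t 1)" using step[OF assms(2)] one by auto
    show ?thesis
    proof (cases "x t 1 \<le> 2")
      case False
      then have "swapped t 1 b = 1" for b by (auto simp: swapped_def doubleton_eq_iff)
      then show ?thesis using x True False by (simp add: transpose_def)
    next
      case le: True
      \<comment> \<open>The partner of label 1 in this swap, hence the only b with factor
        -1.\<close>
      obtain c where c: "c \<in> {1..n}" "x t c = 3 - x t 1"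
      proof (rule x_surj[of t "3 - x t 1"])
        show "t \<le> L" "3 - x t 1 \<in> {1..n}" using assms r le n_ge by auto
      qed
      have c1: "c \<noteq> 1"
      proof
        assume "c = 1"
        then have "x t 1 = 3 - x t 1" using c(2) by simp
        then show False using le by presburger
      qed
      have "swapped t 1 b = (if b = c then -1 else 1)" if "b \<in> {2..n}" for b
      proof -
        have "x t b = x t c \<longleftrightarrow> b = c" using x_inj[of t b c] that c assms by auto
        then show ?thesis using r le c True by (auto simp: swapped_def doubleton_eq_iff)
      qed
      then have "(\<Prod>b\<in>{2..n}. swapped t 1 b) = (\<Prod>b\<in>{2..n}. if b = c then -1 else 1)"
        by (intro prod.cong) auto
      also have "\<dots> = -1" using c c1 by (simp add: prod.delta)
      finally have "(\<Prod>b\<in>{2..n}. swapped t 1 b) = -1" .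
      moreover have "x t 1 = 1 \<or> x t 1 = 2" using r le by linarith
      ultimately show ?thesis using x True by (elim disjE) (simp_all add: transpose_def)
    qed
  qed
qed

lemma parity_walk:
  assumes "even n" "t \<le> L"
  shows "(-1 :: int) ^ x t 1 = - ((-1) ^ nat (rotations 0 t) * (\<Prod>b\<in>{2..n}. swap_parity t 1 b))"
  using assms(2)
proof (induction t)
  case 0
  then show ?case using start[of 1] n_ge by (simp add: rotations_def swap_parity_def)
next
  case (Suc t)
  have "rotations 0 t \<ge> 0" by (simp add: rotations_def sum_nonneg)
  then have "nat (rotations 0 (Suc t)) = nat (rotations 0 t) + nat \<bar>d t\<bar>"
    by (simp add: rotations_def nat_add_distrib)
  then show ?case
    using Suc parity_step[OF assms(1), of t] by (simp add: swap_parity_Suc prod.distrib power_add)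
qed

text \<open>Label 1 goes from position 1 to position 2, so the rotations and the swaps involving it
  are odd in total. Modulo 2 those swaps number \<open>card flipped\<close> - 1.\<close>

lemma flipped_parity:
  assumes "even n"
  shows "even (int (card flipped) - rotations 0 L)"
proof -
  have r: "rotations 0 L \<ge> 0" by (simp add: rotations_def sum_nonneg)
  have fl: "flipped = insert 1 {b \<in> {2..n}. swap_parity L 1 b = -1}"
    using n_ge by (auto simp: flipped_def)
  have "(\<Prod>b\<in>{2..n}. swap_parity L 1 b) = (\<Prod>b\<in>{2..n}. if swap_parity L 1 b = -1 then -1 else 1)"
    using swap_parity_cases by (intro prod.cong) auto
  also have "\<dots> = (-1) ^ card {b \<in> {2..n}. swap_parity L 1 b = -1}"
    by (simp add: prod.inter_filter[symmetric])
  finally have "(\<Prod>b\<in>{2..n}. swap_parity L 1 b) = - ((-1) ^ card flipped)"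
    unfolding fl by simp
  then have "(-1 :: int) ^ x L 1 = (-1) ^ (nat (rotations 0 L) + card flipped)"
    using parity_walk[OF assms order_refl] by (simp add: power_add)
  moreover have "x L 1 = 2" using finish[of 1] n_ge by simp
  ultimately have "even (nat (rotations 0 L) + card flipped)"
    by (simp add: minus_one_power_iff split: if_splits)
  then show ?thesis using r by (simp add: even_nat_iff)
qed

subsection \<open>The range of the pointer\<close>

text \<open>Rotations preserve pointer plus position modulo n. Only a transposition could break
  this, and by assumption the label is never at position 1 or 2 when a step is made.\<close>

lemma label_fixed_if_avoided:
  assumes a: "a \<in> {1..n}" and "t \<le> L"
    and avoid: "\<And>t i. t < L \<Longrightarrow> i \<in> {1, 2} \<Longrightarrow> \<not> int n dvd pointer t + i - int a"
  shows "int n dvd pointer t + int (x t a) - int a"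
  using \<open>t \<le> L\<close>
proof (induction t)
  case 0
  then show ?case using start[OF a] by (simp add: pointer_def)
next
  case (Suc t)
  then have IH: "int n dvd pointer t + int (x t a) - int a" and t: "t < L" by auto
  have r: "1 \<le> x t a" "x t a \<le> n" using x_range[of t a] a t by auto
  have x12: "x t a \<noteq> 1" "x t a \<noteq> 2"
    using IH avoid[OF t, of 1] avoid[OF t, of 2] by auto
  consider "d t = 0" "x (Suc t) a = transpose 1 2 (x t a)"
    | "d t = 1" "x (Suc t) a = (if x t a = 1 then n else x t a - 1)"
    | "d t = -1" "x (Suc t) a = (if x t a = n then 1 else Suc (x t a))"
    using step[OF t] a by blast
  then have "int n dvd (pointer (Suc t) + int (x (Suc t) a)) - (pointer t + int (x t a))"
  proof cases
    case 1
    then show ?thesis using x12 by (simp add: pointer_Suc transpose_def)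
  next
    case 2
    then show ?thesis using x12 r by (simp add: pointer_Suc of_nat_diff)
  next
    case 3
    then show ?thesis by (simp add: pointer_Suc)
  qed
  from dvd_add[OF this IH] show ?case by (simp add: algebra_simps)
qed

text \<open>With a shorter range, positions 1 and 2 would never meet the residues of hi + 3 and hi +
  4 modulo n, so two neighbouring labels would never be swapped. The reflection then makes twice
  each of them congruent to \<open>pointer L\<close> + 3, whence n divides 2.\<close>

lemma pointer_range:
  obtains i j where "i \<le> L" "j \<le> L" "pointer j - pointer i \<ge> int n - 3"
proof -
  let ?S = "pointer ` {..L}"
  have S: "finite ?S" "?S \<noteq> {}" by auto
  define lo where "lo = Min ?S"
  define hi where "hi = Max ?S"
  have "lo \<in> ?S" "hi \<in> ?S" using Min_in[OF S] Max_in[OF S] by (simp_all add: lo_def hi_def)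
  then obtain i j where "i \<in> {..L}" "lo = pointer i" "j \<in> {..L}" "hi = pointer j"
    by (elim imageE)
  then have ij: "i \<le> L" "pointer i = lo" "j \<le> L" "pointer j = hi" by simp_all
  have b: "lo \<le> pointer t" "pointer t \<le> hi" if "t \<le> L" for t
    using S that unfolding lo_def hi_def by auto
  have "hi - lo \<ge> int n - 3"
  proof (rule ccontr)
    assume less: "\<not> hi - lo \<ge> int n - 3"
    have fixed: "int n dvd pointer L + 3 - 2 * (hi + k)" if k: "k \<in> {3, 4}" for k
    proof -
      define a where "a = nat ((hi + k - 1) mod int n + 1)"
      have n: "int n > 0" using n_ge by simp
      have m: "0 \<le> (hi + k - 1) mod int n" "(hi + k - 1) mod int n < int n" using n by simp_all
      have ia: "int a = (hi + k - 1) mod int n + 1" using m by (simp add: a_def)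
      then have a: "a \<in> {1..n}" using m by auto
      have ak: "int n dvd (hi + k) - int a" unfolding ia
        using dvd_minus_mod[of "int n" "hi + k - 1"] by (simp add: algebra_simps)
      have "\<not> int n dvd pointer t + i - int a" if t: "t < L" and i: "i \<in> {1, 2}" for t i
      proof
        assume "int n dvd pointer t + i - int a"
        from dvd_diff[OF ak this] have "int n dvd hi + k - pointer t - i" by (simp add: algebra_simps)
        moreover have "hi + k - pointer t - i > 0" "hi + k - pointer t - i < int n"
          using b[of t] t i k less by auto
        ultimately show False using zdvd_not_zless by blast
      qed
      then have "int n dvd pointer L + int (x L a) - int a"
        using label_fixed_if_avoided[OF a order_refl] by blast
      moreover have "int n dvd 3 - int a - int (x L a)"
        using finish[OF a] a by (auto simp: of_nat_diff split: if_splits)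
      ultimately have "int n dvd (pointer L + int (x L a) - int a) + (3 - int a - int (x L a))"
        by (rule dvd_add)
      from dvd_diff[OF this dvd_mult[OF ak, of 2]] show ?thesis by (simp add: algebra_simps)
    qed
    have "int n dvd (pointer L + 3 - 2 * (hi + 3)) - (pointer L + 3 - 2 * (hi + 4))"
      by (intro dvd_diff fixed) auto
    then have "int n dvd 2" by simp
    then show False using n_ge by (auto dest: zdvd_imp_le)
  qed
  then show ?thesis using that[of i j] ij by auto
qed

end

section \<open>Choice of the crossing and final estimate\<close>

lemma two_times_choose_two: "2 * int (k choose 2) = int k * (int k - 1)"
proof -
  have "even (k * (k - 1))" by (cases k) simp_all
  then have "2 * (k choose 2) = k * (k - 1)" by (simp add: choose_two)
  then have "2 * int (k choose 2) = int (k * (k - 1))" by (metis of_nat_mult of_nat_numeral)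
  then show ?thesis by (cases k) (simp_all add: algebra_simps)
qed

context lrx_walk
begin

lemma rotations_ge_window:
  obtains lo where "\<And>v. lo \<le> v \<Longrightarrow> v < lo + (int n - 3) \<Longrightarrow>
    rotations 0 L \<ge> step2_sum (n - 1) (pointer L) + 1 + circ_norm (int n - 1) (2 * v + 1 - pointer L)"
proof -
  obtain i j where ij: "i \<le> L" "j \<le> L" "pointer j - pointer i \<ge> int n - 3"
    by (rule pointer_range)
  have step1: "\<bar>pointer (Suc t) - pointer t\<bar> \<le> 1" if "t < L" for t
    using d_cases[OF that] by (auto simp: pointer_Suc)
  show ?thesis
  proof (rule that[of "pointer i"])
    fix v assume v: "pointer i \<le> v" "v < pointer i + (int n - 3)"
    then have "v < pointer j" using ij by linarith
    from discrete_crossing[of L pointer, OF step1 ij(1) ij(2) v(1) this]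
    obtain T where "T < L" "{pointer T, pointer (Suc T)} = {v, v + 1}" by blast
    then show "rotations 0 L \<ge> step2_sum (n - 1) (pointer L) + 1 + circ_norm (int n - 1) (2 * v + 1 - pointer L)"
      by (rule rotations_ge_crossing)
  qed
qed

text \<open>For modulus 2m the norm depends only on v modulo m, and the window of 2m - 2 \<ge> m
  values meets every residue. So the argument can be brought as near to the antipode m as its parity
  permits.\<close>

lemma rotations_ge_odd:
  assumes m: "n = 2 * m + 1"
  shows "rotations 0 L \<ge> int m ^ 2 + int m"
proof -
  let ?p = "pointer L"
  have m2: "int m \<ge> 2" and n1: "n - 1 = 2 * m" "int n - 1 = 2 * int m" using n_ge m by auto
  obtain lo where lo: "\<And>v. lo \<le> v \<Longrightarrow> v < lo + (int n - 3) \<Longrightarrow>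
    rotations 0 L \<ge> step2_sum (2 * m) ?p + 1 + circ_norm (2 * int m) (2 * v + 1 - ?p)"
    using rotations_ge_window unfolding n1 by blast
  \<comment> \<open>Of m and m + 1, the one with the parity of 2 * v + 1 -
    \<open>?p\<close>.\<close>
  define c where "c = (if even (?p + int m) then int m + 1 else int m)"
  have "even (?p - 1 + c)" by (auto simp: c_def)
  then obtain v0 where v0: "?p - 1 + c = 2 * v0" by blast
  define v where "v = lo + (v0 - lo) mod int m"
  have "v = v0 - int m * ((v0 - lo) div int m)"
    by (simp add: v_def minus_mult_div_eq_mod[symmetric])
  then have "2 * v + 1 - ?p = c + 2 * int m * (- ((v0 - lo) div int m))"
    using v0 by (simp add: algebra_simps)
  then have norm: "circ_norm (2 * int m) (2 * v + 1 - ?p) = circ_norm (2 * int m) c"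
    by (intro circ_norm_cong) (simp only: mod_mult_self2)
  have "lo \<le> v" "v < lo + int m" using m2 by (simp_all add: v_def)
  then have ge: "rotations 0 L \<ge> step2_sum (2 * m) ?p + 1 + circ_norm (2 * int m) c"
    using lo[of v] norm m m2 by simp
  have c: "circ_norm (2 * int m) c = (if even (?p + int m) then int m - 1 else int m)"
    using m2 by (simp add: c_def circ_norm_def)
  have s0: "step2_sum (2 * m) 0 = (if even m then int m ^ 2 else int m ^ 2 - 1)"
  proof (cases "even m")
    case True
    then obtain j where j: "m = 2 * j" by blast
    then show ?thesis using True unfolding step2_sum_even_0 by (simp add: min_sum_even power2_eq_square)
  next
    case False
    then obtain j where j: "m = Suc (2 * j)" by (auto elim: oddE)
    then show ?thesis using False unfolding step2_sum_even_0 j min_sum_odd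
      by (simp add: power2_eq_square algebra_simps)
  qed
  have s: "step2_sum (2 * m) ?p = (if even ?p then step2_sum (2 * m) 0 else 2 * int m ^ 2 - step2_sum (2 * m) 0)"
    using step2_sum_cong[of ?p 0 "2 * m"] step2_sum_cong[of ?p 1 "2 * m"] step2_sum_0_1[of "2 * m"]
    by (simp add: min_sum_even)
  \<comment> \<open>The sum drops to m^2 - 1 only for odd m and even \<open>?p\<close>, and then the
    norm is m. Otherwise the sum is at least m^2 and the norm at least m - 1.\<close>
  show ?thesis using ge unfolding c s s0 by (auto split: if_splits)
qed

text \<open>The modulus 2m - 1 is odd, so the sum is m^2 - m for every pointer. The window
  guarantees norm m - 2, one below the maximum; \<open>length_ge\<close> recovers this unit by
  parity.\<close>

lemma rotations_ge_even:
  assumes m: "n = 2 * m"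
  shows "rotations 0 L \<ge> int m ^ 2 - 1"
proof -
  let ?p = "pointer L" and ?N = "2 * int m - 1"
  have m2: "int m \<ge> 2" and n1: "int n - 1 = ?N" using n_ge m by auto
  obtain lo where lo: "\<And>v. lo \<le> v \<Longrightarrow> v < lo + (int n - 3) \<Longrightarrow>
    rotations 0 L \<ge> step2_sum (n - 1) ?p + 1 + circ_norm ?N (2 * v + 1 - ?p)"
    using rotations_ge_window unfolding n1 by blast
  have "n - 1 = Suc (2 * (m - 1))" using m n_ge by simp
  then have s: "step2_sum (n - 1) ?p = int m ^ 2 - int m"
    using step2_sum_odd[of "n - 1" ?p] min_sum_odd[of "m - 1"] m2
    by (simp add: of_nat_diff power2_eq_square algebra_simps)
  define z where "z = (2 * lo + 1 - ?p) mod ?N"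
  have z: "0 \<le> z" "z < ?N" using m2 by (simp_all add: z_def)
  \<comment> \<open>The target m - 2, ..., m + 1 is symmetric about half the modulus, and steps of 2
    starting at z cannot jump over it or its translate.\<close>
  obtain i where i: "0 \<le> i" "i < 2 * int m - 3" and window:
    "int m - 2 \<le> z + 2 * i \<and> z + 2 * i \<le> int m + 1 \<or>
      ?N + int m - 2 \<le> z + 2 * i \<and> z + 2 * i \<le> ?N + int m + 1"
  proof -
    have half: "2 * (k div 2) = k \<or> 2 * (k div 2) = k - 1" for k :: int by presburger
    consider "z < int m - 2" | "int m - 2 \<le> z" "z \<le> int m + 1" | "z > int m + 1" by linarith
    then show ?thesis
    proof cases
      case 1
      with half[of "int m - 1 - z"] z m2 show ?thesis
        by (intro that[of "(int m - 1 - z) div 2"]) linarith+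
    next
      case 2
      with m2 show ?thesis by (intro that[of 0]) linarith+
    next
      case 3
      with half[of "3 * int m - 2 - z"] z m2 show ?thesis
        by (intro that[of "(3 * int m - 2 - z) div 2"]) linarith+
    qed
  qed
  from window obtain w where w: "int m - 2 \<le> w" "w \<le> int m + 1" "w mod ?N = (z + 2 * i) mod ?N"
  proof
    assume "int m - 2 \<le> z + 2 * i \<and> z + 2 * i \<le> int m + 1"
    then show ?thesis using that[of "z + 2 * i"] by simp
  next
    assume "?N + int m - 2 \<le> z + 2 * i \<and> z + 2 * i \<le> ?N + int m + 1"
    then show ?thesis using that[of "z + 2 * i - ?N"] by (simp only: minus_mod_self2) linarith
  qed
  have wn: "circ_norm ?N w \<ge> int m - 2"
  proof (cases "w < ?N")
    case True
    then show ?thesis using w m2 by (simp add: circ_norm_def)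
  next
    case False
    \<comment> \<open>Here w = 3 is the modulus itself and has norm 0, but the required bound is
      also 0.\<close>
    then have "m = 2" using w m2 by linarith
    then show ?thesis using circ_norm_def by simp
  qed
  have "(2 * (lo + i) + 1 - ?p) mod ?N = ((2 * lo + 1 - ?p) + 2 * i) mod ?N"
    by (simp add: algebra_simps)
  also have "\<dots> = w mod ?N" unfolding w(3) z_def by (simp add: mod_add_left_eq)
  finally have "circ_norm ?N (2 * (lo + i) + 1 - ?p) = circ_norm ?N w" by (rule circ_norm_cong)
  then show ?thesis using lo[of "lo + i"] i wn s m by simp
qed

lemma length_ge: "n * (n - 1) \<le> 2 * L"
proof -
  let ?s = "int (card flipped)" and ?M = "rotations 0 L"
  have "flipped \<subseteq> {1..n}" by (auto simp: flipped_def)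
  then have "card flipped \<le> n" using card_mono[of "{1..n}" flipped] by simp
  then have sw: "2 * int (card swaps) \<ge> ?s * (?s - 1) + (int n - ?s) * (int n - ?s - 1)"
    using card_swaps_ge two_times_choose_two[of "card flipped"] two_times_choose_two[of "n - card flipped"]
    by (simp add: of_nat_diff)
  have "int n * (int n - 1) \<le> 2 * int L"
  proof (cases "even n")
    case True
    then obtain m where m: "n = 2 * m" by blast
    define j where "j = ?s - int m"
    have "?s * (?s - 1) + (int n - ?s) * (int n - ?s - 1) = 2 * int m ^ 2 - 2 * int m + 2 * j ^ 2"
      unfolding j_def m by (simp add: power2_eq_square algebra_simps)
    then have X: "int (card swaps) \<ge> int m ^ 2 - int m + j ^ 2" using sw by linarith
    have M: "?M \<ge> int m ^ 2 - 1" by (rule rotations_ge_even[OF m])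
    have "int (card swaps) + ?M \<ge> 2 * int m ^ 2 - int m"
    proof (cases "j = 0")
      case True
      then have "even (int m - ?M)" using flipped_parity[OF \<open>even n\<close>] by (simp add: j_def)
      \<comment> \<open>When both cliques have size m, the number of rotations has the parity of m,
        which m^2 - 1 has not.\<close>
      moreover have "odd (int m - (int m ^ 2 - 1))" by simp
      ultimately have "?M \<noteq> int m ^ 2 - 1" by metis
      then show ?thesis using M X True by simp
    next
      case False
      then have "j ^ 2 > 0" by simp
      then show ?thesis using M X by linarith
    qed
    moreover have nn: "int n * (int n - 1) = 2 * (2 * int m ^ 2 - int m)"
      unfolding m by (simp add: power2_eq_square algebra_simps)
    ultimately show ?thesis unfolding nn length_split by simp
  next
    case False
    then obtain m where m: "n = 2 * m + 1" by (auto elim: oddE)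
    define j where "j = ?s - int m"
    have "?s * (?s - 1) + (int n - ?s) * (int n - ?s - 1) = 2 * int m ^ 2 + 2 * (j * (j - 1))"
      unfolding j_def m by (simp add: power2_eq_square algebra_simps)
    moreover have "j * (j - 1) \<ge> 0" by (cases "j \<le> 0") (simp_all add: mult_nonpos_nonpos)
    ultimately have X: "int (card swaps) \<ge> int m ^ 2" using sw by linarith
    have M: "?M \<ge> int m ^ 2 + int m" by (rule rotations_ge_odd[OF m])
    have "int n * (int n - 1) = 2 * (int m ^ 2 + (int m ^ 2 + int m))"
      unfolding m by (simp add: power2_eq_square algebra_simps)
    also have "\<dots> \<le> 2 * int L"
      unfolding length_split by (intro mult_left_mono add_mono X M) simp
    finally show ?thesis .
  qed
  then have "int (n * (n - 1)) \<le> int (2 * L)" using n_ge by (simp add: of_nat_diff)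
  then show ?thesis by (simp only: of_nat_le_iff)
qed

end

subsection \<open>Walks in the Cayley graph\<close>

lemma (in wf_digraph) awalk_vertex_sequence:
  assumes "awalk u p v"
  obtains g where "g 0 = u" "g (length p) = v"
    "\<forall>t<length p. \<exists>e\<in>arcs G. tail G e = g t \<and> head G e = g (Suc t)"
proof -
  have "\<exists>g. g 0 = u \<and> g (length p) = v \<and>
      (\<forall>t<length p. \<exists>e\<in>arcs G. tail G e = g t \<and> head G e = g (Suc t))"
    using assms
  proof (induction p arbitrary: u)
    case Nil
    then show ?case by (auto simp: awalk_Nil_iff intro: exI[of _ "\<lambda>_. u"])
  next
    case (Cons e p)
    then have e: "e \<in> arcs G" "u = tail G e" "awalk (head G e) p v"
      by (simp_all add: awalk_Cons_iff)
    obtain g where g: "g 0 = head G e" "g (length p) = v"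
      "\<forall>t<length p. \<exists>e\<in>arcs G. tail G e = g t \<and> head G e = g (Suc t)"
      using Cons.IH[OF e(3)] by blast
    have "\<exists>e'\<in>arcs G. tail G e' = case_nat u g t \<and> head G e' = case_nat u g (Suc t)"
      if "t < length (e # p)" for t
      using that e(1,2) g(1,3) by (cases t) auto
    then show ?case using g(2) by (intro exI[of _ "case_nat u g"]) auto
  qed
  then show ?thesis using that by blast
qed

definition reflection :: "nat \<Rightarrow> nat \<Rightarrow> nat" where
  "reflection n a = (if a \<in> {1..n} then if a \<le> 2 then 3 - a else n + 3 - a else a)"

lemma reflection_permutes:
  assumes "n \<ge> 2"
  shows "reflection n permutes {1..n}"
  by (rule bij_imp_permutes, rule bij_betw_byWitness[where f' = "reflection n"])
    (use assms in \<open>auto simp: reflection_def\<close>)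

lemma inv_reflection:
  assumes "n \<ge> 2"
  shows "inv' (reflection n) = reflection n"
  by (rule inv_unique_comp) (use assms in \<open>auto simp: reflection_def fun_eq_iff\<close>)

lemma Gamma_walk_length:
  assumes n: "n \<ge> 4"
    and g: "g 0 = id" "g L = reflection n"
    and arcs: "\<And>t. t < L \<Longrightarrow> (g t, g (Suc t)) \<in> parcs (Gamma n)"
  shows "n * (n - 1) \<le> 2 * L"
proof -
  have n3: "3 \<le> n" and n1: "1 \<le> n" and n2: "2 \<le> n" using n by auto
  note arc = iffD1[OF arc_iff[OF n3] arcs]
  have perm: "g t permutes {1..n}" if "t \<le> L" for t
    using that g(2) reflection_permutes[OF n2] arc[of t] by (cases "t = L") auto
  \<comment> \<open>Edges multiply on the right, so inverses turn the generators into maps acting on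
    positions. A step by \<open>rot n\<close> lowers positions cyclically, which is why it gets d t
    = 1.\<close>
  define x where "x t = inv' (g t)" for t
  define d :: "nat \<Rightarrow> int" where "d t = (if inv' (g t) \<circ> g (Suc t) = swap12 then 0
    else if inv' (g t) \<circ> g (Suc t) = rot n then 1 else -1)" for t
  have "lrx_walk n L x d"
  proof
    show "n \<ge> 4" by (rule n)
    show "bij_betw (x t) {1..n} {1..n}" if "t \<le> L" for t
      unfolding x_def by (intro permutes_imp_bij permutes_inv perm that)
    show "x 0 a = a" for a by (simp add: x_def g)
    show "x L a = (if a \<le> 2 then 3 - a else n + 3 - a)" if "a \<in> {1..n}" for a
      using that by (simp add: x_def g inv_reflection[OF n2]) (simp add: reflection_def)
    show "d t = 0 \<and> (\<forall>a\<in>{1..n}. x (Suc t) a = transpose 1 2 (x t a)) \<or>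
        d t = 1 \<and> (\<forall>a\<in>{1..n}. x (Suc t) a = (if x t a = 1 then n else x t a - 1)) \<or>
        d t = -1 \<and> (\<forall>a\<in>{1..n}. x (Suc t) a = (if x t a = n then 1 else Suc (x t a)))"
      if t: "t < L" for t
    proof -
      define s where "s = inv' (g t) \<circ> g (Suc t)"
      have p: "g t permutes {1..n}" "g (Suc t) permutes {1..n}" using perm t by auto
      have ps: "s permutes {1..n}" unfolding s_def by (intro permutes_compose permutes_inv p)
      have "g (Suc t) = g t \<circ> s"
        unfolding s_def by (simp add: comp_assoc[symmetric] permutes_inv_o(1)[OF p(1)])
      then have xs: "x (Suc t) = inv' s \<circ> x t"
        unfolding x_def using o_inv_distrib[OF permutes_bij[OF p(1)] permutes_bij[OF ps]] by simp
      have r: "1 \<le> x t a \<and> x t a \<le> n" if "a \<in> {1..n}" for a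
        using permutes_in_image[OF permutes_inv[OF p(1)], of a] that by (simp add: x_def)
      have "s = swap12 \<or> s = rot n \<or> s = rot_inv n" using arc[OF t] by (simp add: s_def)
      then consider "s = swap12" | "s \<noteq> swap12" "s = rot n" | "s \<noteq> swap12" "s \<noteq> rot n" "s = rot_inv n"
        by blast
      then show ?thesis
      proof cases
        case 1
        then have "d t = 0" by (simp add: d_def s_def)
        then show ?thesis using 1 by (simp add: xs swap12_eq)
      next
        case 2
        then have "d t = 1" by (simp add: d_def s_def)
        moreover have "inv' s = rot_inv n" using 2 rot_inv_eq[OF n1] by simp
        ultimately show ?thesis using r by (simp add: xs rot_inv_apply)
      next
        case 3
        then have "d t = -1" by (simp add: d_def s_def)
        moreover have "inv' s = rot n"
          using 3 rot_inv_eq[OF n1] permutes_inv_inv[OF rot_permutes] by simp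
        ultimately show ?thesis using r by (simp add: xs rot_apply)
      qed
    qed
  qed
  then show ?thesis by (rule lrx_walk.length_ge)
qed

theorem theorem2:
  fixes n :: nat
  assumes "n \<ge> 4"
  shows "diam (Gamma n) \<ge> ereal (real n * (real n - 1) / 2)"
proof -
  have n3: "3 \<le> n" and n2: "2 \<le> n" using assms by auto
  interpret pair_graph "Gamma n" by (rule pair_graph_Gamma[OF n3])
  have verts: "pverts (Gamma n) = {p. p permutes {1..n}}"
    by (simp add: Gamma_def cayley_graph_def sym_group_def)
  have "ereal (real n * (real n - 1) / 2) \<le> dist_graph (Gamma n) id (reflection n)"
    unfolding dist_graph_def \<mu>_def
  \<comment> \<open>The distance is an infimum over walks, so bounding the length of every walk
    suffices.\<close>
  proof (rule INF_greatest)
    fix p assume "p \<in> {p. awalk id p (reflection n)}"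
    then have "awalk id p (reflection n)" by simp
    then obtain g where g: "g 0 = id" "g (length p) = reflection n" and
      arcs: "\<forall>t<length p. \<exists>e\<in>parcs (Gamma n). fst e = g t \<and> snd e = g (Suc t)"
      by (rule awalk_vertex_sequence)
    have arc: "(g t, g (Suc t)) \<in> parcs (Gamma n)" if "t < length p" for t
      using arcs that by (metis prod.collapse)
    have "n * (n - 1) \<le> 2 * length p" by (rule Gamma_walk_length[OF assms g arc])
    then have "real (n * (n - 1)) \<le> real (2 * length p)" by (simp only: of_nat_le_iff)
    moreover have "awalk_cost (\<lambda>_. 1) p = real (length p)" by (induction p) auto
    ultimately show "ereal (real n * (real n - 1) / 2) \<le> ereal (awalk_cost (\<lambda>_. 1) p)"
      using assms by (simp add: of_nat_diff)
  qed
  also have "\<dots> \<le> diam (Gamma n)"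
  proof -
    let ?D = "{dist_graph (Gamma n) u v | u v. u \<in> verts (Gamma n) \<and> v \<in> verts (Gamma n)}"
    have "?D = (\<lambda>(u, v). dist_graph (Gamma n) u v) ` (verts (Gamma n) \<times> verts (Gamma n))" by auto
    then have "finite ?D" by simp
    moreover have "id \<in> verts (Gamma n)" "reflection n \<in> verts (Gamma n)"
      using reflection_permutes[OF n2] permutes_id by (simp_all add: verts)
    then have "dist_graph (Gamma n) id (reflection n) \<in> ?D" by blast
    ultimately show ?thesis unfolding diam_def by (rule Max_ge)
  qed
  finally show ?thesis .
qed

end
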